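(* Let $G$ be an alternating dimap, let $e,f$ be distinct edges of $G$, and let $\mu\in\{1,\omega,\omega^2\}$, where $\omega=\exp(2\pi i/3)$. Then $$G[\mu]e[\mu]f = G[\mu]f[\mu]e,$$ where $H[\mu]e$ denotes the $\mu$-reduction of $H$ by $e$ and successive reductions are applied from left to right.
   Context: An \emph{alternating dimap} is a finite directed graph (loops and multiple edges allowed) without isolated vertices, 2-cell-embedded in a disjoint union of oriented surfaces (orientable 2-manifolds, one for each component), such that around each vertex the incident edges are directed alternately into and out of the vertex. The empty alternating dimap is allowed. All edges around a face go in the same direction; a face is a \emph{c-face} (clockwise) or \emph{a-face} (anticlockwise) accordingly. An \emph{in-star} is the set of all edges directed into some vertex. Each edge $e$ lies in exactly one c-face $C(e)$, one a-face $A(e)$ and one in-star $I(e)$. The \emph{left successor} (resp. \emph{right successor}) of $e$ is the next edge after $e$ going around $A(e)$ (resp. $C(e)$) in the direction of $e$. Let $\omega=\exp(2\pi i/3)$. The permutations $\sigma_1,\sigma_\omega,\sigma_{\omega^2}$ of $E(G)$ send $e$ to the next edge in clockwise order around $I(e)$, $A(e)$, $C(e)$ respectively (outgoing edges are skipped in going around an in-star). So the left successor of $e$ is $\sigma_\omega^{-1}(e)$ and the right successor is $\sigma_{\omega^2}(e)$. They satisfy $\sigma_1\sigma_\omega\sigma_{\omega^2}=\mathrm{id}$ (rightmost applied first), and alternating dimaps correspond bijectively to triples of permutations of a finite set satisfying this identity. Two alternating dimaps are equal when they have the same edge set and the same triple. \emph{Minor operations.} Let $e$ be an edge from $u$ to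 $v$. 1-reduction $G[1]e$ (contraction): if $e$ is not a loop, delete $e$ and identify its endpoints, preserving the order of edges and faces around vertices; if $e$ alone forms an a-face or a c-face, delete $e$; if $e$ is any other loop, with cyclic order of edge-ends around $v$ being $e$ (directed in)$,a_1,b_1,\ldots,a_k,b_k,e$ (directed out)$,c_1,d_1,\ldots,c_l,d_l$, delete $e$ and replace $v$ by two vertices $v_1,v_2$, with the ends $a_i,b_i$ reattached to $v_1$ and the ends $c_i,d_i$ to $v_2$, in the induced cyclic orders. $\omega$-reduction $G[\omega]e$: delete $e$ and, if the left successor $g$ of $e$ is not $e$ itself, change the tail of $g$ from $v$ to $u$ so that $g$ takes the place of $e,g$ in $A(e)$. $\omega^2$-reduction $G[\omega^2]e$: delete $e$ and, if the right successor $h$ of $e$ is not $e$ itself, change the tail of $h$ from $v$ to $u$ so that $h$ takes the place of $e,h$ in $C(e)$. A vertex left without edges disappears. Equivalently, writing $\pi\setminus e$ for the permutation of $E\setminus\{e\}$ obtained from $\pi$ by removing $e$ from its cycle: in $G[1]e$, $\sigma_\omega$ and $\sigma_{\omega^2}$ become $\sigma_\omega\setminus e$ and $\sigma_{\omega^2}\setminus e$; in $G[\omega]e$, $\sigma_1$ and $\sigma_\omega$ become $\sigma_1\setminus e$ and $\sigma_\omega\setminus e$; in $G[\omega^2]e$, $\sigma_1$ and $\sigma_{\omega^2}$ become $\sigma_1\setminus e$ and $\sigma_{\omega^2}\setminus e$; in each case the third permutation is determined by the product identity. *)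

theory Defs
  imports Complex_Main "HOL-Combinatorics.Permutations"
begin

text \<open>
  A graph that is 2-cell embedded in a disjoint union of oriented surfaces, one per component, is
  given by its rotation system: the permutation sending each edge-end to the next edge-end in
  clockwise order around its vertex.  The vertices are the cycles of this permutation, so that
  there are no isolated vertices, a vertex left without edges disappears, and vertices carry no
  names.  \<open>Hd e\<close> is the end of \<open>e\<close> at its head (directed into the vertex) and \<open>Tl e\<close> the end at
  its tail (directed out of the vertex).
\<close>

datatype 'e edge_end = Hd (edge_of: 'e) | Tl (edge_of: 'e)

record 'e dimap =
  edges :: "'e set"
  rot :: "'e edge_end \<Rightarrow> 'e edge_end"

definition alternating_dimap :: "'e dimap \<Rightarrow> bool" where
  "alternating_dimap G \<longleftrightarrow>
     finite (edges G) \<and>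
     rot G permutes (Hd ` edges G \<union> Tl ` edges G) \<and>
     (\<forall>e\<in>edges G. rot G (Hd e) \<in> range Tl \<and> rot G (Tl e) \<in> range Hd)"

text \<open>
  The a-face of \<open>e\<close> lies to the left of \<open>e\<close> and its c-face to the right.  Arriving at the head of
  \<open>e\<close>, the walk around the a-face continues along the edge whose tail end comes next after \<open>e\<close> in
  clockwise order, and the walk around the c-face along the edge whose tail end comes next in
  anticlockwise order.  The edge following \<open>e\<close> in the direction of \<open>e\<close> is the next one in
  clockwise order around the c-face, but the previous one in clockwise order around the a-face.
\<close>

definition left_succ :: "'e dimap \<Rightarrow> 'e \<Rightarrow> 'e" where
  "left_succ G e = edge_of (rot G (Hd e))"

definition right_succ :: "'e dimap \<Rightarrow> 'e \<Rightarrow> 'e" where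
  "right_succ G e = edge_of (inv (rot G) (Hd e))"

definition sigma_1 :: "'e dimap \<Rightarrow> 'e \<Rightarrow> 'e" where
  "sigma_1 G e = edge_of (rot G (rot G (Hd e)))"

definition sigma_omega :: "'e dimap \<Rightarrow> 'e \<Rightarrow> 'e" where
  "sigma_omega G = inv (left_succ G)"

definition sigma_omega2 :: "'e dimap \<Rightarrow> 'e \<Rightarrow> 'e" where
  "sigma_omega2 G = right_succ G"

text \<open>\<open>excise p x\<close> removes \<open>x\<close> from its cycle in the permutation \<open>p\<close>, leaving \<open>x\<close> as a fixed point.\<close>

definition excise :: "('a \<Rightarrow> 'a) \<Rightarrow> 'a \<Rightarrow> 'a \<Rightarrow> 'a" where
  "excise p x = (\<lambda>y. if y = x then x else if p y = x then p x else p y)"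

definition delete_ends :: "'e \<Rightarrow> ('e edge_end \<Rightarrow> 'e edge_end) \<Rightarrow> 'e edge_end \<Rightarrow> 'e edge_end" where
  "delete_ends e r = excise (excise r (Hd e)) (Tl e)"

text \<open>
  If \<open>x\<close> and \<open>y\<close> lie on different cycles \<open>x, p\<^sub>1, \<dots>, p\<^sub>m\<close> and \<open>y, q\<^sub>1, \<dots>, q\<^sub>n\<close> of \<open>r\<close>, then
  \<open>r \<circ> transpose x y\<close> joins them into \<open>x, q\<^sub>1, \<dots>, q\<^sub>n, y, p\<^sub>1, \<dots>, p\<^sub>m\<close>; if they lie on one cycle
  \<open>x, p\<^sub>1, \<dots>, p\<^sub>m, y, q\<^sub>1, \<dots>, q\<^sub>n\<close>, it splits that cycle into \<open>y, p\<^sub>1, \<dots>, p\<^sub>m\<close> and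
  \<open>x, q\<^sub>1, \<dots>, q\<^sub>n\<close>.  After deletion of \<open>x = Hd e\<close> and \<open>y = Tl e\<close>, the former is the
  identification of the endpoints of a non-loop \<open>e\<close>, and the latter the replacement of the vertex
  of a loop \<open>e\<close> by two vertices.
\<close>

definition reduce_1 :: "'e dimap \<Rightarrow> 'e \<Rightarrow> 'e dimap" where
  "reduce_1 G e =
     \<lparr> edges = edges G - {e},
       rot = delete_ends e
         (if left_succ G e = e \<or> right_succ G e = e then rot G
          else rot G \<circ> transpose (Hd e) (Tl e)) \<rparr>"

text \<open>
  Conjugation by \<open>transpose x y\<close> exchanges the positions of \<open>x\<close> and \<open>y\<close> in the cyclic orders.
  Here it moves the tail end of the successor of \<open>e\<close> into the position of \<open>Tl e\<close>, while \<open>Tl e\<close>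
  takes the vacated position and is then deleted.
\<close>

definition exchange :: "'a \<Rightarrow> 'a \<Rightarrow> ('a \<Rightarrow> 'a) \<Rightarrow> 'a \<Rightarrow> 'a" where
  "exchange x y r = transpose x y \<circ> r \<circ> transpose x y"

definition reduce_omega :: "'e dimap \<Rightarrow> 'e \<Rightarrow> 'e dimap" where
  "reduce_omega G e =
     (let g = left_succ G e in
      \<lparr> edges = edges G - {e},
        rot = delete_ends e (if g = e then rot G else exchange (Tl e) (Tl g) (rot G)) \<rparr>)"

definition reduce_omega2 :: "'e dimap \<Rightarrow> 'e \<Rightarrow> 'e dimap" where
  "reduce_omega2 G e =
     (let h = right_succ G e in
      \<lparr> edges = edges G - {e},
        rot = delete_ends e (if h = e then rot G else exchange (Tl e) (Tl h) (rot G)) \<rparr>)"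

definition omega :: complex where
  "omega = exp (2 * complex_of_real pi * \<i> / 3)"

text \<open>Only the values 1, \<open>omega\<close>, \<open>omega\<^sup>2\<close> of \<open>\<mu>\<close> are meaningful.\<close>

definition reduce :: "'e dimap \<Rightarrow> complex \<Rightarrow> 'e \<Rightarrow> 'e dimap" where
  "reduce G \<mu> e =
     (if \<mu> = 1 then reduce_1 G e
      else if \<mu> = omega then reduce_omega G e
      else if \<mu> = omega\<^sup>2 then reduce_omega2 G e
      else G)"

text \<open>
  Agreement with the description of alternating dimaps and their reductions by triples of
  permutations: the product identity, equality of alternating dimaps as equality of edge sets and
  triples (two of the permutations determine the third), and the removal of \<open>e\<close> from two of the
  three permutations in each of the reductions.
\<close>

context
  fixes G :: "'e dimap"
  assumes G: "alternating_dimap G"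
begin

lemma rot_permutes: "rot G permutes (Hd ` edges G \<union> Tl ` edges G)"
  using G by (simp add: alternating_dimap_def)

lemma rot_bij: "bij (rot G)"
  using rot_permutes by (rule permutes_bij)

lemma rot_outside: "e \<notin> edges G \<Longrightarrow> rot G (Hd e) = Hd e" "e \<notin> edges G \<Longrightarrow> rot G (Tl e) = Tl e"
  using rot_permutes by (auto simp: permutes_def)

lemma rot_Hd: "e \<in> edges G \<Longrightarrow> rot G (Hd e) = Tl (left_succ G e)"
  using G by (auto simp: alternating_dimap_def left_succ_def)

lemma rot_Tl_right_succ: "e \<in> edges G \<Longrightarrow> rot G (Tl (right_succ G e)) = Hd e"
proof -
  assume e: "e \<in> edges G"
  let ?x = "inv (rot G) (Hd e)"
  have r: "rot G ?x = Hd e" using rot_bij by (simp add: bij_is_surj surj_f_inv_f)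
  show ?thesis
  proof (cases ?x)
    case (Hd z)
    then show ?thesis using r e rot_outside(1)[of z] rot_Hd[of z] by (cases "z \<in> edges G") auto
  next
    case (Tl z) then show ?thesis using r by (simp add: right_succ_def)
  qed
qed

lemma succ_in_edges:
  assumes "e \<in> edges G" shows "left_succ G e \<in> edges G" "right_succ G e \<in> edges G"
proof -
  show "left_succ G e \<in> edges G"
    using rot_Hd[OF assms] permutes_in_image[OF rot_permutes, of "Hd e"] assms by auto
  show "right_succ G e \<in> edges G"
    using rot_Tl_right_succ[OF assms] rot_outside(2)[of "right_succ G e"] by force
qed

lemma succ_outside:
  assumes "e \<notin> edges G" shows "left_succ G e = e" "right_succ G e = e"
  using rot_outside[OF assms] rot_bij
  by (auto simp: left_succ_def right_succ_def bij_is_inj inv_f_eq)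

lemma left_succ_permutes: "left_succ G permutes edges G"
proof (rule bij_imp_permutes)
  have "inj_on (left_succ G) (edges G)"
    by (metis bij_is_inj[OF rot_bij] edge_end.inject(1) injD inj_onI rot_Hd)
  moreover have "finite (edges G)" using G by (simp add: alternating_dimap_def)
  ultimately show "bij_betw (left_succ G) (edges G) (edges G)"
    by (simp add: bij_betw_def endo_inj_surj image_subsetI succ_in_edges)
qed (simp add: succ_outside)

lemma sigma_omega_permutes: "sigma_omega G permutes edges G"
  unfolding sigma_omega_def by (rule permutes_inv[OF left_succ_permutes])

lemma sigma_omega2_permutes: "sigma_omega2 G permutes edges G"
  unfolding sigma_omega2_def
proof (rule bij_imp_permutes)
  have "inj_on (right_succ G) (edges G)"
    by (metis edge_end.inject(1) inj_onI rot_Tl_right_succ)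
  moreover have "finite (edges G)" using G by (simp add: alternating_dimap_def)
  ultimately show "bij_betw (right_succ G) (edges G) (edges G)"
    by (simp add: bij_betw_def endo_inj_surj image_subsetI succ_in_edges)
qed (simp add: succ_outside)

lemma right_succ_sigma_1: "right_succ G (sigma_1 G e) = left_succ G e"
proof (cases "e \<in> edges G")
  case True
  then have l: "left_succ G e \<in> edges G" by (rule succ_in_edges)
  then obtain x where x: "rot G (Tl (left_succ G e)) = Hd x"
    using G by (auto simp: alternating_dimap_def)
  then have "inv (rot G) (Hd x) = Tl (left_succ G e)"
    using rot_bij by (simp add: bij_is_inj inv_f_eq)
  then show ?thesis using x True by (simp add: sigma_1_def right_succ_def rot_Hd)
next
  case False
  then show ?thesis by (simp add: sigma_1_def rot_outside succ_outside)
qed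

theorem sigma_product: "sigma_1 G \<circ> sigma_omega G \<circ> sigma_omega2 G = id"
proof -
  have L: "bij (left_succ G)" and R: "bij (right_succ G)"
    using permutes_bij left_succ_permutes sigma_omega2_permutes
    by (auto simp: sigma_omega2_def)
  have "right_succ G (sigma_1 G (sigma_omega G (right_succ G e))) = right_succ G e" for e
    using L by (simp add: right_succ_sigma_1 sigma_omega_def bij_is_surj surj_f_inv_f)
  then show ?thesis
    using R by (auto simp: fun_eq_iff sigma_omega2_def bij_is_inj inj_eq)
qed

end

lemma dimap_eqI:
  assumes G: "alternating_dimap G" and H: "alternating_dimap H"
    and "edges G = edges H" "sigma_omega G = sigma_omega H" "sigma_omega2 G = sigma_omega2 H"
  shows "G = H"
proof -
  have L: "left_succ G = left_succ H"
    using assms(4) left_succ_permutes[OF G] left_succ_permutes[OF H]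
    unfolding sigma_omega_def by (metis inv_inv_eq permutes_bij)
  have R: "right_succ G = right_succ H" using assms(5) by (simp add: sigma_omega2_def)
  have "rot G x = rot H x" for x
  proof (cases "edge_of x \<in> edges G")
    case True
    show ?thesis
    proof (cases x)
      case (Hd e)
      then show ?thesis using True L assms(3) by (simp add: rot_Hd[OF G] rot_Hd[OF H])
    next
      case (Tl e)
      obtain d where d: "d \<in> edges G" "right_succ G d = e"
        using True Tl sigma_omega2_permutes[OF G]
        by (metis edge_end.sel(2) image_iff permutes_image sigma_omega2_def)
      then show ?thesis
        using rot_Tl_right_succ[OF G d(1)] rot_Tl_right_succ[OF H, of d] R Tl assms(3) by simp
    qed
  next
    case False
    then show ?thesis using assms(3) by (cases x) (simp_all add: rot_outside[OF G] rot_outside[OF H])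
  qed
  then show ?thesis using assms(3) by (cases G, cases H) auto
qed

lemma excise_transpose: "excise p x = transpose x (p x) \<circ> p" if "inj p"
  using that by (auto simp: fun_eq_iff excise_def transpose_def inj_eq)

lemma excise_permutes:
  assumes "p permutes A" shows "excise p x permutes (A - {x})"
proof (cases "x \<in> A")
  case True
  have "excise p x permutes A"
    unfolding excise_transpose[OF permutes_inj[OF assms]]
    by (rule permutes_compose[OF assms permutes_swap_id])
       (simp_all add: True permutes_in_image[OF assms])
  then show ?thesis by (rule permutes_superset) (auto simp: excise_def)
next
  case False
  then have "excise p x = p" using assms permutes_inj[OF assms]
    by (auto simp: fun_eq_iff excise_def permutes_def inj_eq)
  then show ?thesis using assms False by simp
qed

lemma delete_ends_permutes:
  assumes "r permutes (Hd ` A \<union> Tl ` A)"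
  shows "delete_ends e r permutes (Hd ` (A - {e}) \<union> Tl ` (A - {e}))"
proof -
  have "Hd ` (A - {e}) \<union> Tl ` (A - {e}) = Hd ` A \<union> Tl ` A - {Hd e} - {Tl e}" by auto
  then show ?thesis unfolding delete_ends_def by (metis excise_permutes assms)
qed

lemma inv_excise:
  assumes "bij p" shows "inv (excise p x) = excise (inv p) x"
proof -
  have [simp]: "inv p (p y) = y" "p (inv p y) = y" "inv p y = z \<longleftrightarrow> y = p z" "p y = p z \<longleftrightarrow> y = z" for y z
    using assms by (auto simp: bij_is_inj bij_is_surj surj_f_inv_f inj_eq)
  show ?thesis
    by (rule inv_unique_comp) (auto simp: fun_eq_iff excise_def)
qed

context
  fixes G :: "'e dimap" and e :: 'e
  assumes G: "alternating_dimap G" and e: "e \<in> edges G"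
begin

definition right_pred :: "'e \<Rightarrow> 'e" where
  "right_pred d = edge_of (rot G (Tl d))"

lemma rot_Tl: "d \<in> edges G \<Longrightarrow> rot G (Tl d) = Hd (right_pred d)"
  using G by (auto simp: alternating_dimap_def right_pred_def)

lemma reduce_permutes:
  "rot (reduce_1 G e) permutes (Hd ` (edges G - {e}) \<union> Tl ` (edges G - {e}))"
  "rot (reduce_omega G e) permutes (Hd ` (edges G - {e}) \<union> Tl ` (edges G - {e}))"
  "rot (reduce_omega2 G e) permutes (Hd ` (edges G - {e}) \<union> Tl ` (edges G - {e}))"
  using e succ_in_edges[OF G e] rot_permutes[OF G]
  by (auto simp: reduce_1_def reduce_omega_def reduce_omega2_def Let_def exchange_def
    intro!: delete_ends_permutes permutes_compose permutes_swap_id)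

lemma left_succ_eq_iff: "left_succ G x = left_succ G y \<longleftrightarrow> x = y"
  using left_succ_permutes[OF G] by (metis permutes_def)
lemma right_succ_eq_iff: "right_succ G x = right_succ G y \<longleftrightarrow> x = y"
  using sigma_omega2_permutes[OF G] unfolding sigma_omega2_def by (metis permutes_def)
lemma right_pred_right_succ: "d \<in> edges G \<Longrightarrow> right_pred (right_succ G d) = d"
  using rot_Tl_right_succ[OF G] by (simp add: right_pred_def)
lemma right_succ_right_pred: "d \<in> edges G \<Longrightarrow> right_succ G (right_pred d) = d"
  using rot_Tl rot_bij[OF G] by (metis bij_inv_eq_iff edge_end.sel(2) right_succ_def)
lemma right_pred_in_edges: "d \<in> edges G \<Longrightarrow> right_pred d \<in> edges G"
  by (metis right_succ_right_pred succ_outside(2)[OF G])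
lemma right_pred_eq: "d \<in> edges G \<Longrightarrow> right_pred d = e \<longleftrightarrow> d = right_succ G e"
  using right_pred_right_succ[OF e] right_succ_right_pred by auto

lemmas rot_rules = rot_Hd[OF G] rot_Tl e succ_in_edges[OF G]

lemma rot_reduce_1:
  assumes "d \<in> edges G" "d \<noteq> e"
  shows "rot (reduce_1 G e) (Hd d) = Tl (excise (left_succ G) e d)"
   "rot (reduce_1 G e) (Tl d) = Hd (excise right_pred e d)"
  using assms right_pred_right_succ[OF e] right_succ_right_pred[OF assms(1)]
    right_pred_eq[OF e] right_pred_eq[OF assms(1)] left_succ_eq_iff[of d e]
  by (auto simp: reduce_1_def delete_ends_def excise_def transpose_def rot_rules)

lemma rot_reduce_omega:
  assumes "d \<in> edges G" "d \<noteq> e"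
  shows "rot (reduce_omega G e) (Hd d) = Tl (excise (left_succ G) e d)"
   "rot (reduce_omega G e) (Tl d) = Hd
     (let v = right_pred (if d = left_succ G e then e else d)
      in if v = e then right_pred (left_succ G e) else v)"
  using assms right_pred_right_succ[OF e] right_succ_right_pred[OF assms(1)]
    right_pred_eq[OF e] right_pred_eq[OF assms(1)] left_succ_eq_iff[of d e]
    right_pred_eq[OF succ_in_edges(1)[OF G e]]
  by (auto simp: reduce_omega_def delete_ends_def excise_def transpose_def rot_rules exchange_def Let_def)

lemma rot_reduce_omega2:
  assumes "d \<in> edges G" "d \<noteq> e"
  shows "rot (reduce_omega2 G e) (Hd d) = Tl
     (if left_succ G d = e then if right_succ G e = e then left_succ G e else right_succ G e
      else if left_succ G d = right_succ G e
      then if left_succ G e = e then right_succ G e else left_succ G e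
      else left_succ G d)"
   "rot (reduce_omega2 G e) (Tl d) = Hd (excise right_pred e d)"
  using assms right_pred_right_succ[OF e] right_succ_right_pred[OF assms(1)]
    right_pred_eq[OF e] right_pred_eq[OF assms(1)] left_succ_eq_iff[of d e]
  by (auto simp: reduce_omega2_def delete_ends_def excise_def transpose_def rot_rules exchange_def Let_def)

lemma edges_reduce: "edges (reduce_1 G e) = edges G - {e}" "edges (reduce_omega G e) = edges G - {e}"
 "edges (reduce_omega2 G e) = edges G - {e}"
  by (simp_all add: reduce_1_def reduce_omega_def reduce_omega2_def Let_def)

lemma reduce_alternating:
  "alternating_dimap (reduce_1 G e)" "alternating_dimap (reduce_omega G e)"
  "alternating_dimap (reduce_omega2 G e)"
  using G reduce_permutes rot_reduce_1 rot_reduce_omega rot_reduce_omega2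
  by (auto simp: alternating_dimap_def edges_reduce)

lemma sigma_omega2_reduceI:
  assumes H: "alternating_dimap H" "edges H = edges G - {e}"
    and "\<And>d. d \<in> edges G \<Longrightarrow> d \<noteq> e \<Longrightarrow>
      rot H (Tl d) = Hd (excise right_pred e d)"
  shows "sigma_omega2 H = excise (sigma_omega2 G) e"
  unfolding sigma_omega2_def
proof
  fix d show "right_succ H d = excise (right_succ G) e d"
  proof (cases "d \<in> edges G \<and> d \<noteq> e")
    case True
    let ?r = "excise (right_succ G) e d"
    have r: "?r \<in> edges G" "?r \<noteq> e"
      using True succ_in_edges[OF G] e right_succ_eq_iff[of d e]
      by (auto simp: excise_def)
    have "excise right_pred e ?r = d"
      using True e right_pred_right_succ succ_in_edges[OF G] right_succ_eq_iff[of d e]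
      by (auto simp: excise_def)
    then have "rot H (Tl ?r) = Hd d" using assms(3)[OF r] by simp
    then show ?thesis using rot_bij[OF H(1)] by (metis bij_inv_eq_iff edge_end.sel(2) right_succ_def)
  next
    case False
    then show ?thesis
      using succ_outside(2)[OF H(1), of d] succ_outside(2)[OF G, of d] H(2) e
      by (cases "d = e") (auto simp: excise_def)
  qed
qed

lemma sigma_omega_reduceI:
  assumes H: "alternating_dimap H" "edges H = edges G - {e}"
    and "\<And>d. d \<in> edges G \<Longrightarrow> d \<noteq> e \<Longrightarrow>
      rot H (Hd d) = Tl (excise (left_succ G) e d)"
  shows "sigma_omega H = excise (sigma_omega G) e"
proof -
  have "left_succ H d = excise (left_succ G) e d" for d
  proof (cases "d \<in> edges G \<and> d \<noteq> e")
    case True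
    then show ?thesis by (simp add: left_succ_def[of H] assms(3))
  next
    case False
    then show ?thesis
      using succ_outside(1)[OF H(1), of d] succ_outside(1)[OF G, of d] H(2) e
      by (cases "d = e") (auto simp: excise_def)
  qed
  then have "left_succ H = excise (left_succ G) e" ..
  then show ?thesis unfolding sigma_omega_def
    by (simp add: inv_excise permutes_bij[OF left_succ_permutes[OF G]])
qed

lemma sigma_1_eq: "d \<in> edges G \<Longrightarrow> sigma_1 G d = right_pred (left_succ G d)"
  using succ_in_edges[OF G] by (simp add: sigma_1_def rot_Hd[OF G] rot_Tl)

lemma sigma_1_reduceI:
  assumes H: "alternating_dimap H" "edges H = edges G - {e}"
    and "\<And>d. d \<in> edges G \<Longrightarrow> d \<noteq> e \<Longrightarrow>
      edge_of (rot H (rot H (Hd d))) = excise (sigma_1 G) e d"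
  shows "sigma_1 H = excise (sigma_1 G) e"
proof
  fix d show "sigma_1 H d = excise (sigma_1 G) e d"
  proof (cases "d \<in> edges G \<and> d \<noteq> e")
    case True
    then show ?thesis by (simp add: sigma_1_def[of H] assms(3))
  next
    case False
    have out: "sigma_1 K d = d" if "alternating_dimap K" "d \<notin> edges K" for K :: "'e dimap"
      using rot_outside(1)[OF that] by (simp add: sigma_1_def)
    show ?thesis
      using False out[OF H(1)] out[OF G] H(2) e by (cases "d = e") (auto simp: excise_def)
  qed
qed

theorem reduce_1_sigma:
  "sigma_omega (reduce_1 G e) = excise (sigma_omega G) e"
  "sigma_omega2 (reduce_1 G e) = excise (sigma_omega2 G) e"
  by (rule sigma_omega_reduceI sigma_omega2_reduceI; simp add: reduce_alternating edges_reduce rot_reduce_1)+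

theorem reduce_omega_sigma:
  "sigma_1 (reduce_omega G e) = excise (sigma_1 G) e"
  "sigma_omega (reduce_omega G e) = excise (sigma_omega G) e"
proof -
  show "sigma_1 (reduce_omega G e) = excise (sigma_1 G) e"
  proof (rule sigma_1_reduceI)
    fix d assume d: "d \<in> edges G" "d \<noteq> e"
    let ?l = "excise (left_succ G) e d"
    let ?v = "right_pred (if ?l = left_succ G e then e else ?l)"
    have l: "?l \<in> edges G" "?l \<noteq> e"
      using d succ_in_edges[OF G] e left_succ_eq_iff[of d e] by (auto simp: excise_def)
    have "rot (reduce_omega G e) (rot (reduce_omega G e) (Hd d)) =
        Hd (let v = ?v in if v = e then right_pred (left_succ G e) else v)"
      unfolding rot_reduce_omega(1)[OF d] using l by (rule rot_reduce_omega(2))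
    moreover have "(let v = ?v in if v = e then right_pred (left_succ G e) else v) = excise (sigma_1 G) e d"
    proof (cases "left_succ G d = e")
      case True
      then have "?v = sigma_1 G d" using d by (simp add: excise_def sigma_1_eq)
      then show ?thesis using d e by (simp add: excise_def sigma_1_eq)
    next
      case False
      then have "?v = sigma_1 G d" using d left_succ_eq_iff[of d e] by (simp add: excise_def sigma_1_eq)
      then show ?thesis using d e by (simp add: excise_def sigma_1_eq)
    qed
    ultimately show "edge_of (rot (reduce_omega G e) (rot (reduce_omega G e) (Hd d))) =
        excise (sigma_1 G) e d"
      by simp
  qed (simp_all add: reduce_alternating edges_reduce)
qed (rule sigma_omega_reduceI; simp add: reduce_alternating edges_reduce rot_reduce_omega)

theorem reduce_omega2_sigma:
  "sigma_1 (reduce_omega2 G e) = excise (sigma_1 G) e"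
  "sigma_omega2 (reduce_omega2 G e) = excise (sigma_omega2 G) e"
proof -
  show "sigma_1 (reduce_omega2 G e) = excise (sigma_1 G) e"
  proof (rule sigma_1_reduceI)
    fix d assume d: "d \<in> edges G" "d \<noteq> e"
    let ?l = "if left_succ G d = e then if right_succ G e = e then left_succ G e else right_succ G e
      else if left_succ G d = right_succ G e
      then if left_succ G e = e then right_succ G e else left_succ G e
      else left_succ G d"
    have l: "?l \<in> edges G" "?l \<noteq> e"
      using d succ_in_edges[OF G] e left_succ_eq_iff[of d e] by (auto split: if_splits)
    have "rot (reduce_omega2 G e) (rot (reduce_omega2 G e) (Hd d)) = Hd (excise right_pred e ?l)"
      unfolding rot_reduce_omega2(1)[OF d] using l by (rule rot_reduce_omega2(2))
    moreover have "excise right_pred e ?l = excise (sigma_1 G) e d"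
      using d e left_succ_eq_iff[of d e] right_pred_right_succ[OF e] right_pred_eq
        succ_in_edges[OF G d(1)] succ_in_edges[OF G e]
      by (auto simp: excise_def sigma_1_eq)
    ultimately show "edge_of (rot (reduce_omega2 G e) (rot (reduce_omega2 G e) (Hd d))) = excise (sigma_1 G) e d"
      by simp
  qed (simp_all add: reduce_alternating edges_reduce)
qed (rule sigma_omega2_reduceI; simp add: reduce_alternating edges_reduce rot_reduce_omega2)

end

end

theory Submission
  imports Defs
begin

text \<open>
  Each reduction by \<open>e\<close> removes \<open>e\<close> from its cycle in two of the three permutations, and these two
  determine the dimap.  Removing two elements from the cycles of a permutation does not depend on
  the order in which they are removed.
\<close>

lemma excise_commute:
  assumes "inj p"
  shows "excise (excise p x) y = excise (excise p y) x"
  \<comment> \<open>Both sides fix \<open>x\<close> and \<open>y\<close> and send any other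
    \<open>z\<close> to the first of \<open>p z\<close>, \<open>p (p z)\<close>,
    \<open>p (p (p z))\<close> outside \<open>{x, y}\<close>; injectivity keeps the orbit of
    \<open>z\<close> from being trapped there.\<close>
  using assms by (auto simp: fun_eq_iff excise_def inj_eq)

context
  fixes G :: "'e dimap"
  assumes G: "alternating_dimap G"
begin

text \<open>By the product identity \<open>sigma_1\<close> is a left inverse of a permutation, hence
  its inverse and itself a permutation.\<close>

lemma sigma_1_eq_inv: "sigma_1 G = inv (sigma_omega G \<circ> sigma_omega2 G)"
  and sigma_1_permutes: "sigma_1 G permutes edges G"
proof -
  have p: "sigma_omega G \<circ> sigma_omega2 G permutes edges G"
    by (rule permutes_compose[OF sigma_omega2_permutes[OF G] sigma_omega_permutes[OF G]])
  have "sigma_1 G \<circ> (sigma_omega G \<circ> sigma_omega2 G) = id"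
    using sigma_product[OF G] by (simp add: comp_assoc)
  then show "sigma_1 G = inv (sigma_omega G \<circ> sigma_omega2 G)"
    by (metis comp_assoc comp_id id_comp permutes_inv_o(1)[OF p])
  then show "sigma_1 G permutes edges G"
    using permutes_inv[OF p] by simp
qed

lemma inv_sigma_1: "inv (sigma_1 G) = sigma_omega G \<circ> sigma_omega2 G"
  using sigma_1_eq_inv permutes_compose[OF sigma_omega2_permutes[OF G] sigma_omega_permutes[OF G]]
  by (metis inv_inv_eq permutes_bij)

text \<open>Serves the \<omega>^2-reduction, whose known effect is on \<open>sigma_1\<close> and
  \<open>sigma_omega2\<close>, whereas \<open>dimap_eqI\<close> compares \<open>sigma_omega\<close>
  and \<open>sigma_omega2\<close>.\<close>

lemma sigma_omega_eq: "sigma_omega G = inv (sigma_1 G) \<circ> inv (sigma_omega2 G)"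
  by (simp add: inv_sigma_1 comp_assoc permutes_inv_o(1)[OF sigma_omega2_permutes[OF G]])

lemma sigma_omega2_eq: "sigma_omega2 G = inv (sigma_omega G) \<circ> inv (sigma_1 G)"
  by (simp add: inv_sigma_1 comp_assoc[symmetric] permutes_inv_o(2)[OF sigma_omega_permutes[OF G]])

lemmas inj_sigma =
  permutes_inj[OF sigma_1_permutes]
  permutes_inj[OF sigma_omega_permutes[OF G]]
  permutes_inj[OF sigma_omega2_permutes[OF G]]

end

context
  fixes G :: "'e dimap" and e f :: 'e
  assumes G: "alternating_dimap G"
    and e: "e \<in> edges G" and f: "f \<in> edges G" and ef: "e \<noteq> f"
begin

lemma reduce_1_commute: "reduce_1 (reduce_1 G e) f = reduce_1 (reduce_1 G f) e"
proof -
  note alt = reduce_alternating(1)[OF G e] reduce_alternating(1)[OF G f]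
  \<comment> \<open>The second reduction excises an edge only if that edge survived the
    first.\<close>
  have f': "f \<in> edges (reduce_1 G e)" and e': "e \<in> edges (reduce_1 G f)"
    using e f ef by (simp_all add: edges_reduce[OF G])
  show ?thesis
    by (rule dimap_eqI)
       (use alt e f e' f' in \<open>auto simp: reduce_alternating edges_reduce reduce_1_sigma G
         excise_commute inj_sigma\<close>)
qed

text \<open>Here \<open>sigma_omega2\<close> is not simply excised, so it is rewritten through the
  other two permutations, whose excisions commute.\<close>

lemma reduce_omega_commute: "reduce_omega (reduce_omega G e) f = reduce_omega (reduce_omega G f) e"
proof -
  note alt = reduce_alternating(2)[OF G e] reduce_alternating(2)[OF G f]
  have f': "f \<in> edges (reduce_omega G e)" and e': "e \<in> edges (reduce_omega G f)"
    using e f ef by (simp_all add: edges_reduce[OF G])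
  show ?thesis
    by (rule dimap_eqI)
       (use alt e f e' f' in \<open>auto simp: reduce_alternating edges_reduce reduce_omega_sigma G
         sigma_omega2_eq excise_commute inj_sigma\<close>)
qed

lemma reduce_omega2_commute: "reduce_omega2 (reduce_omega2 G e) f = reduce_omega2 (reduce_omega2 G f) e"
proof -
  note alt = reduce_alternating(3)[OF G e] reduce_alternating(3)[OF G f]
  have f': "f \<in> edges (reduce_omega2 G e)" and e': "e \<in> edges (reduce_omega2 G f)"
    using e f ef by (simp_all add: edges_reduce[OF G])
  show ?thesis
    by (rule dimap_eqI)
       (use alt e f e' f' in \<open>auto simp: reduce_alternating edges_reduce reduce_omega2_sigma G
         sigma_omega_eq excise_commute inj_sigma\<close>)
qed

end

theorem theorem7:
  fixes G :: "'e dimap" and e f :: 'e and \<mu> :: complex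
  assumes "alternating_dimap G"
    and "e \<in> edges G" and "f \<in> edges G" and "e \<noteq> f"
    and "\<mu> \<in> {1, omega, omega\<^sup>2}"
  shows "reduce (reduce G \<mu> e) \<mu> f = reduce (reduce G \<mu> f) \<mu> e"
  \<comment> \<open>The branch of \<open>reduce\<close> depends on \<mu> alone, so all four
    reductions are of one kind.\<close>
  using reduce_1_commute[OF assms(1-4)] reduce_omega_commute[OF assms(1-4)]
    reduce_omega2_commute[OF assms(1-4)]
  by (simp add: reduce_def)

end
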